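(* Let $A$ be an $n\times n$ nonnegative real matrix with spectral radius $\rho(A)$ all of whose row sums are nonzero. Then for any integers $M>0$, $N\ge 0$ and $k\ge 0$, \[ \min_{\substack{1\le i,j\le n\\ a_{ij}^{(M)}>0}} \left( \frac{r_i(A^{k+M})\, r_j(A^{k+N})}{r_i(A^k)\, r_j(A^k)} \right)^{\frac{1}{M+N}} \le \rho(A) \le \max_{\substack{1\le i,j\le n\\ a_{ij}^{(M)}>0}} \left( \frac{r_i(A^{k+M})\, r_j(A^{k+N})}{r_i(A^k)\, r_j(A^k)} \right)^{\frac{1}{M+N}}. \] Moreover, if $A^{M+N}$ is irreducible, then equality holds on either side (and hence on both sides) of this inequality if and only if $x=(r_1(A^k),\ldots,r_n(A^k))^T$ is an eigenvector of $A$.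
   Context: $a_{ij}^{(m)}$ denotes the $(i,j)$ entry of $A^m$ (with $A^0=I$), and $r_i(B)=\sum_j b_{ij}$ denotes the $i$-th row sum of a matrix $B$. A nonnegative $n\times n$ matrix $B$ ($n\ge2$) is reducible if there is a permutation matrix $P$ with $PBP^T=\begin{pmatrix}X&Y\\0&Z\end{pmatrix}$, $X,Z$ square; otherwise irreducible. $\rho(A)$ is the maximum modulus of the eigenvalues of $A$. *)

theory Defs
  imports "Jordan_Normal_Form.Spectral_Radius" "HOL-Combinatorics.Permutations"
begin

definition nonneg_mat :: "real mat \<Rightarrow> bool" where
  "nonneg_mat A \<longleftrightarrow> (\<forall>i<dim_row A. \<forall>j<dim_col A. 0 \<le> A $$ (i,j))"

definition row_sum :: "real mat \<Rightarrow> nat \<Rightarrow> real" where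
  "row_sum B i = (\<Sum>j<dim_col B. B $$ (i,j))"

definition row_sums_vec :: "real mat \<Rightarrow> real vec" where
  "row_sums_vec B = vec (dim_row B) (row_sum B)"

definition real_spectral_radius :: "real mat \<Rightarrow> real" where
  "real_spectral_radius A = spectral_radius (map_mat complex_of_real A)"

definition is_permutation_mat :: "nat \<Rightarrow> real mat \<Rightarrow> bool" where
  "is_permutation_mat n P \<longleftrightarrow>
     (\<exists>p. p permutes {..<n} \<and> P = mat n n (\<lambda>(i,j). if j = p i then 1 else 0))"

(* Both diagonal blocks are required to be nonempty. Hence a reducible matrix has
   size at least 2, and every 1 x 1 matrix counts as irreducible. *)
definition reducible_mat :: "real mat \<Rightarrow> bool" where
  "reducible_mat B \<longleftrightarrow>
     (\<exists>P X Y Z r s. 0 < r \<and> 0 < s \<and> B \<in> carrier_mat (r + s) (r + s) \<and>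
        is_permutation_mat (r + s) P \<and>
        X \<in> carrier_mat r r \<and> Y \<in> carrier_mat r s \<and> Z \<in> carrier_mat s s \<and>
        P * B * transpose_mat P = four_block_mat X Y (0\<^sub>m s r) Z)"

definition irreducible_mat :: "real mat \<Rightarrow> bool" where
  "irreducible_mat B \<longleftrightarrow> square_mat B \<and> \<not> reducible_mat B"

(* The denominators are positive when A is nonnegative with nonzero row sums; the set is
   then finite, and nonempty for a matrix of positive size. *)
definition row_sum_ratios :: "real mat \<Rightarrow> nat \<Rightarrow> nat \<Rightarrow> nat \<Rightarrow> real set" where
  "row_sum_ratios A M N k =
     {((row_sum (A ^\<^sub>m (k + M)) i * row_sum (A ^\<^sub>m (k + N)) j) /
       (row_sum (A ^\<^sub>m k) i * row_sum (A ^\<^sub>m k) j)) powr (1 / real (M + N)) | i j.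
        i < dim_row A \<and> j < dim_row A \<and> (A ^\<^sub>m M) $$ (i,j) > 0}"

end

theory Submission
  imports Defs
begin

text \<open>Put \<open>x = A\<^sup>k 1 > 0\<close> and \<open>m = M + N\<close>. Expanding \<open>(A\<^sup>m x)\<^sub>i\<close> as a sum of
  \<open>(A\<^sup>M)\<^sub>i\<^sub>j (A\<^sup>N x)\<^sub>j\<close> shows \<open>l\<^sup>m x \<le> A\<^sup>m x \<le> h\<^sup>m x\<close> for the minimum \<open>l\<close> and the maximum \<open>h\<close>
  of the ratios, and the Collatz--Wielandt principle gives \<open>l \<le> \<rho>(A) \<le> h\<close>. If one bound is
  attained and \<open>A\<^sup>m\<close> is irreducible, then \<open>A\<^sup>m x = \<rho>\<^sup>m x\<close>, since a strict inequality at one index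
  could be spread to all indices. The positive eigenvector of \<open>A\<^sup>m\<close> is unique up to scaling and
  \<open>A\<close> commutes with \<open>A\<^sup>m\<close>, so \<open>x\<close> is an eigenvector of \<open>A\<close>.\<close>

section \<open>Nonnegative matrices acting on vectors\<close>

lemma mult_mat_vec_sum:
  assumes "A \<in> carrier_mat n n" "v \<in> carrier_vec n" "i < n"
  shows "(A *\<^sub>v v) $ i = (\<Sum>j<n. A $$ (i,j) * v $ j)"
  using assms by (auto simp: scalar_prod_def lessThan_atLeast0 intro!: sum.cong)

lemma pow_mat_add:
  assumes "(A :: 'a :: semiring_1 mat) \<in> carrier_mat n n"
  shows "A ^\<^sub>m (a + b) = A ^\<^sub>m a * A ^\<^sub>m b"
proof (induction b)
  case 0
  then show ?case using assms by simp
next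
  case (Suc b)
  then show ?case
    using assoc_mult_mat[OF pow_carrier_mat[OF assms] pow_carrier_mat[OF assms] assms] by simp
qed

lemma pow_mat_add_mult_vec:
  assumes "(A :: 'a :: semiring_1 mat) \<in> carrier_mat n n" "v \<in> carrier_vec n"
  shows "A ^\<^sub>m (a + b) *\<^sub>v v = A ^\<^sub>m a *\<^sub>v (A ^\<^sub>m b *\<^sub>v v)"
  unfolding pow_mat_add[OF assms(1)]
  using assoc_mult_mat_vec[OF pow_carrier_mat[OF assms(1)] pow_carrier_mat[OF assms(1)] assms(2)] .

lemma smult_pow_mat:
  assumes "(A :: 'a :: comm_semiring_1 mat) \<in> carrier_mat n n"
  shows "(c \<cdot>\<^sub>m A) ^\<^sub>m k = c ^ k \<cdot>\<^sub>m (A ^\<^sub>m k)"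
proof (induction k)
  case 0
  then show ?case using assms by (intro eq_matI) auto
next
  case (Suc k)
  have "c ^ k \<cdot>\<^sub>m (A ^\<^sub>m k) * (c \<cdot>\<^sub>m A) = (c ^ k * c) \<cdot>\<^sub>m (A ^\<^sub>m k * A)"
    using assms by (intro eq_matI) (auto simp: scalar_prod_def sum_distrib_left ac_simps)
  then show ?case using Suc by (simp add: mult.commute)
qed

lemma smult_mat_mult_vec:
  assumes "(A :: 'a :: comm_semiring_1 mat) \<in> carrier_mat n n" "v \<in> carrier_vec n"
  shows "(c \<cdot>\<^sub>m A) *\<^sub>v v = c \<cdot>\<^sub>v (A *\<^sub>v v)"
  using assms by (intro eq_vecI) (auto simp: scalar_prod_def sum_distrib_left ac_simps)

lemma nonneg_matD:
  assumes "nonneg_mat A" "A \<in> carrier_mat n n" "i < n" "j < n"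
  shows "0 \<le> A $$ (i,j)"
  using assms by (auto simp: nonneg_mat_def)

lemma nonneg_mat_mult:
  assumes "A \<in> carrier_mat n n" "B \<in> carrier_mat n n" "nonneg_mat A" "nonneg_mat B"
  shows "nonneg_mat (A * B)"
  using assms unfolding nonneg_mat_def by (auto simp: scalar_prod_def intro!: sum_nonneg)

lemma nonneg_mat_pow:
  assumes "A \<in> carrier_mat n n" "nonneg_mat A"
  shows "nonneg_mat (A ^\<^sub>m k)"
proof (induction k)
  case 0
  then show ?case by (auto simp: nonneg_mat_def)
next
  case (Suc k)
  then show ?case using nonneg_mat_mult[OF pow_carrier_mat[OF assms(1)] assms(1)] assms by simp
qed

lemma mult_mat_vec_mono:
  assumes "A \<in> carrier_mat n n" "nonneg_mat A" "v \<in> carrier_vec n" "w \<in> carrier_vec n"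
    and "\<And>j. j < n \<Longrightarrow> v $ j \<le> w $ j" and "i < n"
  shows "(A *\<^sub>v v) $ i \<le> (A *\<^sub>v w) $ i"
  unfolding mult_mat_vec_sum[OF assms(1,3,6)] mult_mat_vec_sum[OF assms(1,4,6)]
  using assms(5) nonneg_matD[OF assms(2,1,6)] by (intro sum_mono mult_left_mono) auto

lemma mult_mat_vec_nonneg:
  assumes "A \<in> carrier_mat n n" "nonneg_mat A" "v \<in> carrier_vec n"
    and "\<And>j. j < n \<Longrightarrow> 0 \<le> v $ j" and "i < n"
  shows "0 \<le> (A *\<^sub>v v) $ i"
  unfolding mult_mat_vec_sum[OF assms(1,3,5)]
  using assms(4) nonneg_matD[OF assms(2,1,5)] by (intro sum_nonneg mult_nonneg_nonneg) auto

text \<open>A nonnegative row with nonzero sum has a positive entry, and that entry alone makes the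
  scalar product with a positive vector positive.\<close>

lemma mult_mat_vec_pos:
  assumes A: "A \<in> carrier_mat n n" "nonneg_mat A" and v: "v \<in> carrier_vec n"
    and nz: "\<And>i. i < n \<Longrightarrow> row_sum A i \<noteq> 0"
    and pos: "\<And>j. j < n \<Longrightarrow> 0 < v $ j" and i: "i < n"
  shows "0 < (A *\<^sub>v v) $ i"
proof -
  have "\<exists>j<n. A $$ (i,j) \<noteq> 0"
  proof (rule ccontr)
    assume "\<not> ?thesis"
    then have "row_sum A i = 0" using A by (auto simp: row_sum_def)
    with nz[OF i] show False by simp
  qed
  then obtain j where j: "j < n" "A $$ (i,j) \<noteq> 0" by auto
  then have "0 < A $$ (i,j) * v $ j" using nonneg_matD[OF A(2,1) i j(1)] pos by simp
  then show ?thesis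
    unfolding mult_mat_vec_sum[OF A(1) v i]
    using j nonneg_matD[OF A(2,1) i] pos
    by (intro sum_pos2[of _ j]) (auto simp: less_imp_le)
qed

lemma pow_mat_mult_vec_pos:
  assumes A: "A \<in> carrier_mat n n" "nonneg_mat A" and v: "v \<in> carrier_vec n"
    and nz: "\<And>i. i < n \<Longrightarrow> row_sum A i \<noteq> 0"
    and pos: "\<And>j. j < n \<Longrightarrow> 0 < v $ j" and i: "i < n"
  shows "0 < (A ^\<^sub>m k *\<^sub>v v) $ i"
  using i
proof (induction k arbitrary: i)
  case 0
  then show ?case using A v pos by simp
next
  case (Suc k)
  have "A ^\<^sub>m Suc k *\<^sub>v v = A *\<^sub>v (A ^\<^sub>m k *\<^sub>v v)"
    using pow_mat_add_mult_vec[OF A(1) v, of 1 k] A by simp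
  moreover have "A ^\<^sub>m k *\<^sub>v v \<in> carrier_vec n"
    using pow_carrier_mat[OF A(1)] v by (rule mult_mat_vec_carrier)
  ultimately show ?case using mult_mat_vec_pos[OF A _ nz Suc.IH Suc.prems] by simp
qed

section \<open>Row sums of powers as images of the all-ones vector\<close>

lemma row_sums_vec_eq_mult_one:
  assumes "B \<in> carrier_mat n n"
  shows "row_sums_vec B = B *\<^sub>v vec n (\<lambda>_. 1)"
proof (intro eq_vecI)
  fix i assume "i < dim_vec (B *\<^sub>v vec n (\<lambda>_. 1))"
  then have "i < n" using assms by simp
  then show "row_sums_vec B $ i = (B *\<^sub>v vec n (\<lambda>_. 1)) $ i"
    using assms by (subst mult_mat_vec_sum[of _ n]) (simp_all add: row_sums_vec_def row_sum_def)
qed (use assms in \<open>simp add: row_sums_vec_def\<close>)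

text \<open>Turns every row sum in the ratios into an entry of a power of \<open>A\<close> applied
  to the single vector \<open>x = row_sums_vec (A ^\<^sub>m k)\<close>.\<close>

lemma row_sum_pow_add:
  assumes A: "A \<in> carrier_mat n n" and i: "i < n"
  shows "row_sum (A ^\<^sub>m (k + l)) i = (A ^\<^sub>m l *\<^sub>v row_sums_vec (A ^\<^sub>m k)) $ i"
proof -
  have "row_sum (A ^\<^sub>m (k + l)) i = row_sums_vec (A ^\<^sub>m (l + k)) $ i"
    using A i by (simp add: row_sums_vec_def add.commute)
  also have "\<dots> = (A ^\<^sub>m l *\<^sub>v row_sums_vec (A ^\<^sub>m k)) $ i"
    using A by (simp add: row_sums_vec_eq_mult_one[of _ n] pow_mat_add_mult_vec[of _ n])
  finally show ?thesis .
qed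

text \<open>Multiply the claim by \<open>(C *\<^sub>v x) $ i > 0\<close>. Expanding this factor on
  the \<open>L\<close> side and \<open>(C *\<^sub>v y) $ i\<close> on the other gives two sums over
  \<open>j\<close> with common weights \<open>C $$ (i,j)\<close>, compared term by term. Zero
  weights drop out, which is why only positive entries of \<open>C\<close> need a hypothesis. It is
  applied with \<open>C\<close> the \<open>M\<close>-th power and \<open>y\<close> the
  \<open>N\<close>-th power of \<open>A\<close> applied to \<open>x\<close>.\<close>

lemma mult_mat_vec_compare:
  assumes C: "C \<in> carrier_mat n n" "nonneg_mat C" and x: "x \<in> carrier_vec n"
    and y: "y \<in> carrier_vec n" and i: "i < n" and pos: "0 < (C *\<^sub>v x) $ i"
  shows "(\<And>j. j < n \<Longrightarrow> 0 < C $$ (i,j) \<Longrightarrow> L * (x $ i * x $ j) \<le> (C *\<^sub>v x) $ i * y $ j)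
      \<Longrightarrow> L * x $ i \<le> (C *\<^sub>v y) $ i"
    and "(\<And>j. j < n \<Longrightarrow> 0 < C $$ (i,j) \<Longrightarrow> (C *\<^sub>v x) $ i * y $ j \<le> L * (x $ i * x $ j))
      \<Longrightarrow> (C *\<^sub>v y) $ i \<le> L * x $ i"
proof -
  have 1: "(C *\<^sub>v x) $ i * (L * x $ i) = (\<Sum>j<n. C $$ (i,j) * (L * (x $ i * x $ j)))"
    unfolding mult_mat_vec_sum[OF C(1) x i] sum_distrib_right by (simp add: ac_simps)
  have 2: "(C *\<^sub>v x) $ i * (C *\<^sub>v y) $ i = (\<Sum>j<n. C $$ (i,j) * ((C *\<^sub>v x) $ i * y $ j))"
    by (subst mult_mat_vec_sum[OF C(1) y i]) (simp add: sum_distrib_left ac_simps del: index_mult_mat_vec)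
  note nn = nonneg_matD[OF C(2,1) i]
  { assume *: "\<And>j. j < n \<Longrightarrow> 0 < C $$ (i,j) \<Longrightarrow> L * (x $ i * x $ j) \<le> (C *\<^sub>v x) $ i * y $ j"
    have "C $$ (i,j) * (L * (x $ i * x $ j)) \<le> C $$ (i,j) * ((C *\<^sub>v x) $ i * y $ j)"
      if "j < n" for j
      using *[OF that] nn[OF that] by (cases "C $$ (i,j) = 0") (auto intro: mult_left_mono)
    then have "(C *\<^sub>v x) $ i * (L * x $ i) \<le> (C *\<^sub>v x) $ i * (C *\<^sub>v y) $ i"
      unfolding 1 2 by (intro sum_mono) simp
    then show "L * x $ i \<le> (C *\<^sub>v y) $ i" using pos by (rule mult_left_le_imp_le) }
  { assume *: "\<And>j. j < n \<Longrightarrow> 0 < C $$ (i,j) \<Longrightarrow> (C *\<^sub>v x) $ i * y $ j \<le> L * (x $ i * x $ j)"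
    have "C $$ (i,j) * ((C *\<^sub>v x) $ i * y $ j) \<le> C $$ (i,j) * (L * (x $ i * x $ j))"
      if "j < n" for j
      using *[OF that] nn[OF that] by (cases "C $$ (i,j) = 0") (auto intro: mult_left_mono)
    then have "(C *\<^sub>v x) $ i * (C *\<^sub>v y) $ i \<le> (C *\<^sub>v x) $ i * (L * x $ i)"
      unfolding 1 2 by (intro sum_mono) simp
    then show "(C *\<^sub>v y) $ i \<le> L * x $ i" using pos by (rule mult_left_le_imp_le) }
qed

section \<open>Collatz--Wielandt bounds\<close>

lemma real_spectral_radius_eigenvector:
  assumes A: "A \<in> carrier_mat n n" and n: "0 < n"
  obtains z \<mu> where "eigenvector (map_mat complex_of_real A) z \<mu>"
    "norm \<mu> = real_spectral_radius A"
proof -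
  have "map_mat complex_of_real A \<in> carrier_mat n n" using A by simp
  from spectral_radius_mem_max(1)[OF this n] show ?thesis
    using that unfolding real_spectral_radius_def spectrum_def eigenvalue_def by force
qed

lemma real_spectral_radius_nonneg:
  assumes "A \<in> carrier_mat n n" "0 < n"
  shows "0 \<le> real_spectral_radius A"
  using real_spectral_radius_eigenvector[OF assms] norm_ge_zero by metis

lemma norm_le_real_spectral_radius:
  assumes A: "A \<in> carrier_mat n n" and n: "0 < n"
    and "eigenvector (map_mat complex_of_real A) z \<mu>"
  shows "norm \<mu> \<le> real_spectral_radius A"
proof -
  have "map_mat complex_of_real A \<in> carrier_mat n n" using A by simp
  from spectral_radius_mem_max(2)[OF this n] show ?thesis
    using assms(3) unfolding real_spectral_radius_def spectrum_def eigenvalue_def by blast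
qed

lemma map_mat_of_real_pow:
  assumes "A \<in> carrier_mat n n"
  shows "map_mat complex_of_real A ^\<^sub>m k = map_mat complex_of_real (A ^\<^sub>m k)"
  by (rule of_real_hom.mat_hom_pow[OF assms, symmetric])

text \<open>The index is one at which a complex eigenvector \<open>z\<close> for \<open>\<rho>(A)\<close> maximises \<open>|z\<^sub>i| / x\<^sub>i\<close>.\<close>

lemma spectral_radius_pow_le_at:
  assumes A: "A \<in> carrier_mat n n" "nonneg_mat A" and n: "0 < n"
    and x: "x \<in> carrier_vec n" and pos: "\<And>i. i < n \<Longrightarrow> 0 < x $ i"
  shows "\<exists>i<n. real_spectral_radius A ^ m * x $ i \<le> (A ^\<^sub>m m *\<^sub>v x) $ i"
proof -
  let ?A = "map_mat complex_of_real A" and ?\<rho> = "real_spectral_radius A"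
  have A': "?A \<in> carrier_mat n n" using A by simp
  obtain z \<mu> where ev: "eigenvector ?A z \<mu>" and \<rho>: "norm \<mu> = ?\<rho>"
    using real_spectral_radius_eigenvector[OF A(1) n] .
  have z: "z \<in> carrier_vec n" "z \<noteq> 0\<^sub>v n" using ev A by (auto simp: eigenvector_def)
  define q where "q i = norm (z $ i) / x $ i" for i
  define t where "t = Max (q ` {..<n})"
  have ne: "q ` {..<n} \<noteq> {}" using n by auto
  have "t \<in> q ` {..<n}" unfolding t_def using ne by (intro Max_in) auto
  then obtain i where i: "i < n" "q i = t" by auto
  have qt: "q j \<le> t" if "j < n" for j unfolding t_def using that by (intro Max_ge) auto
  \<comment> \<open>An eigenvector has a nonzero entry, so \<open>t > 0\<close> and \<open>t\<close>
    can be cancelled at the end.\<close>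
  obtain j where j: "j < n" "z $ j \<noteq> 0" using z by (metis carrier_vecD eq_vecI index_zero_vec)
  have "0 < q j" using j pos by (simp add: q_def)
  then have t: "0 < t" using qt[OF j(1)] by simp
  have zt: "norm (z $ j) \<le> t * x $ j" if "j < n" for j
    using qt[OF that] pos[OF that] by (simp add: q_def field_simps)
  have zi: "norm (z $ i) = t * x $ i" using i pos[OF i(1)] by (auto simp: q_def field_simps)
  have "?A ^\<^sub>m m *\<^sub>v z = \<mu> ^ m \<cdot>\<^sub>v z" by (rule eigenvector_pow[OF A' ev])
  then have "\<mu> ^ m * z $ i = (map_mat complex_of_real (A ^\<^sub>m m) *\<^sub>v z) $ i"
    using z i map_mat_of_real_pow[OF A(1)] by simp
  also have "\<dots> = (\<Sum>j<n. complex_of_real ((A ^\<^sub>m m) $$ (i,j)) * z $ j)"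
    using A z i by (subst mult_mat_vec_sum[of _ n]) auto
  finally have "norm (\<mu> ^ m * z $ i) \<le> (\<Sum>j<n. norm (complex_of_real ((A ^\<^sub>m m) $$ (i,j)) * z $ j))"
    by (simp add: norm_sum)
  \<comment> \<open>After the triangle inequality, every \<open>norm (z $ j)\<close> is replaced by
    its bound \<open>t * x $ j\<close>; on the left this bound is an equality, by the choice of
    \<open>i\<close>.\<close>
  also have "\<dots> \<le> (\<Sum>j<n. (A ^\<^sub>m m) $$ (i,j) * (t * x $ j))"
    using nonneg_matD[OF nonneg_mat_pow[OF A] pow_carrier_mat[OF A(1)] i(1)] zt
    by (intro sum_mono) (auto simp: norm_mult intro!: mult_left_mono)
  also have "\<dots> = t * (A ^\<^sub>m m *\<^sub>v x) $ i"
    unfolding mult_mat_vec_sum[OF pow_carrier_mat[OF A(1)] x i(1)]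
    by (simp add: sum_distrib_left ac_simps)
  finally have "t * (?\<rho> ^ m * x $ i) \<le> t * (A ^\<^sub>m m *\<^sub>v x) $ i"
    using zi \<rho> by (simp add: norm_mult norm_power ac_simps)
  then show ?thesis using t i by (intro exI[of _ i]) auto
qed

text \<open>Dividing by \<open>r\<close> brings the spectral radius strictly below 1, where the
  Jordan normal form bounds all powers by one constant.\<close>

lemma pow_mat_bounded_if_spectral_radius_less:
  assumes A: "A \<in> carrier_mat n n" and n: "0 < n"
    and r: "0 < r" "real_spectral_radius A < r"
  shows "\<exists>c. \<forall>k. \<forall>i<n. \<forall>j<n. \<bar>(((1 / r) \<cdot>\<^sub>m A) ^\<^sub>m k) $$ (i,j)\<bar> \<le> c"
proof -
  define S where "S = (1 / r) \<cdot>\<^sub>m A"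
  have S: "S \<in> carrier_mat n n" using A by (simp add: S_def)
  have S': "map_mat complex_of_real S \<in> carrier_mat n n" using S by simp
  have "real_spectral_radius S < 1"
  proof -
    obtain z \<mu> where ev: "eigenvector (map_mat complex_of_real S) z \<mu>"
      and l: "norm \<mu> = real_spectral_radius S"
      using real_spectral_radius_eigenvector[OF S n] .
    have z: "z \<in> carrier_vec n" using ev A by (simp add: eigenvector_def S_def)
    \<comment> \<open>Scaling back: an eigenvalue \<open>\<mu>\<close> of \<open>S\<close> of
      maximal modulus gives the eigenvalue \<open>r * \<mu>\<close> of \<open>A\<close>, whose
      modulus is at most the spectral radius of \<open>A\<close>, hence below
      \<open>r\<close>.\<close>
    have "map_mat complex_of_real A = complex_of_real r \<cdot>\<^sub>m map_mat complex_of_real S"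
      using r A by (intro eq_matI) (auto simp: S_def)
    then have "map_mat complex_of_real A *\<^sub>v z = complex_of_real r \<cdot>\<^sub>v (\<mu> \<cdot>\<^sub>v z)"
      using ev smult_mat_mult_vec[OF S' z] by (simp add: eigenvector_def)
    then have "eigenvector (map_mat complex_of_real A) z (complex_of_real r * \<mu>)"
      using ev A by (simp add: eigenvector_def S_def smult_smult_assoc)
    from norm_le_real_spectral_radius[OF A n this]
    have "r * norm \<mu> \<le> real_spectral_radius A" using r by (simp add: norm_mult)
    then have "r * norm \<mu> < r * 1" using r(2) by linarith
    then show ?thesis using mult_less_cancel_left_pos[OF r(1)] l by metis
  qed
  then obtain c where c: "\<And>k. norm_bound (map_mat complex_of_real S ^\<^sub>m k) c"
    using spectral_radius_jnf_norm_bound_less_1_upper_triangular[OF S']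
    unfolding real_spectral_radius_def by blast
  have "\<bar>(S ^\<^sub>m k) $$ (i,j)\<bar> \<le> c" if "i < n" "j < n" for k i j
    using c[of k] that S unfolding norm_bound_def map_mat_of_real_pow[OF S] by auto
  then show ?thesis unfolding S_def by blast
qed

text \<open>Otherwise \<open>A\<^sup>m x \<ge> q x\<close> with \<open>q > \<rho>\<^sup>m\<close>, and for \<open>\<rho> < r < q\<^sup>1\<^sup>/\<^sup>m\<close> the powers of \<open>A / r\<close> would grow.\<close>

lemma spectral_radius_pow_ge_at:
  assumes A: "A \<in> carrier_mat n n" "nonneg_mat A" and n: "0 < n" and m: "0 < m"
    and x: "x \<in> carrier_vec n" and pos: "\<And>i. i < n \<Longrightarrow> 0 < x $ i"
  shows "\<exists>i<n. (A ^\<^sub>m m *\<^sub>v x) $ i \<le> real_spectral_radius A ^ m * x $ i"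
proof (rule ccontr)
  let ?\<rho> = "real_spectral_radius A"
  assume "\<not> ?thesis"
  then have gt: "?\<rho> ^ m * x $ i < (A ^\<^sub>m m *\<^sub>v x) $ i" if "i < n" for i
    using that by force
  \<comment> \<open>The least quotient \<open>q\<close> turns the strict inequalities at all indices
    into one uniform factor, still above the \<open>m\<close>-th power of the spectral
    radius.\<close>
  define g where "g i = (A ^\<^sub>m m *\<^sub>v x) $ i / x $ i" for i
  define q where "q = Min (g ` {..<n})"
  have ne: "g ` {..<n} \<noteq> {}" using n by auto
  have "q \<in> g ` {..<n}" unfolding q_def using ne by (intro Min_in) auto
  then obtain i where i: "i < n" "q = g i" by auto
  have "?\<rho> ^ m * x $ i < q * x $ i" using gt[OF i(1)] pos[OF i(1)] i(2) by (simp add: g_def)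
  then have "?\<rho> ^ m < q" using pos[OF i(1)] by simp
  have qx: "q * x $ j \<le> (A ^\<^sub>m m *\<^sub>v x) $ j" if "j < n" for j
  proof -
    have "q \<le> g j" unfolding q_def using that by (intro Min_le) auto
    then show ?thesis using pos[OF that] by (simp add: g_def field_simps)
  qed
  have \<rho>: "0 \<le> ?\<rho>" by (rule real_spectral_radius_nonneg[OF A(1) n])
  have "?\<rho> < root m q"
    using \<open>?\<rho> ^ m < q\<close> \<rho> m by (metis real_root_less_mono real_root_power_cancel)
  then obtain r where r: "?\<rho> < r" "r < root m q" using dense by blast
  then have r0: "0 < r" using \<rho> by simp
  have "0 < q" using \<open>?\<rho> ^ m < q\<close> \<rho> by (meson le_less_trans zero_le_power)
  then have "r ^ m < q"
    using power_strict_mono[OF r(2), of m] r0 m by (simp add: real_root_pow_pos2)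
  \<comment> \<open>The factor by which \<open>m\<close> applications of \<open>A / r\<close>
    enlarge \<open>x\<close> at least, entry by entry; it exceeds 1 because \<open>r\<close> was
    taken below the \<open>m\<close>-th root of \<open>q\<close>.\<close>
  define t where "t = q / r ^ m"
  have t: "1 < t" using \<open>r ^ m < q\<close> r0 by (simp add: t_def)
  define S where "S = (1 / r) \<cdot>\<^sub>m A"
  have S: "S \<in> carrier_mat n n" "nonneg_mat S" using A r0 by (auto simp: S_def nonneg_mat_def)
  have Sc: "S ^\<^sub>m k *\<^sub>v x \<in> carrier_vec n" for k
    using pow_carrier_mat[OF S(1)] x by (rule mult_mat_vec_carrier)
  have Sx: "t * x $ j \<le> (S ^\<^sub>m m *\<^sub>v x) $ j" if "j < n" for j
  proof -
    have "(S ^\<^sub>m m *\<^sub>v x) $ j = (A ^\<^sub>m m *\<^sub>v x) $ j / r ^ m"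
      using smult_mat_mult_vec[OF pow_carrier_mat[OF A(1)] x] that A x
      by (simp add: S_def smult_pow_mat[OF A(1)] power_divide)
    then show ?thesis using qx[OF that] r0 by (simp add: t_def divide_right_mono)
  qed
  have grow: "t ^ p * x $ j \<le> (S ^\<^sub>m (m * p) *\<^sub>v x) $ j" if "j < n" for p j
    using that
  proof (induction p arbitrary: j)
    case 0
    then show ?case using S x by simp
  next
    case (Suc p)
    have "t ^ Suc p * x $ j = t ^ p * (t * x $ j)" by simp
    also have "\<dots> \<le> t ^ p * (S ^\<^sub>m m *\<^sub>v x) $ j"
      using Sx[OF Suc.prems] t by (intro mult_left_mono) auto
    also have "\<dots> = (S ^\<^sub>m m *\<^sub>v (t ^ p \<cdot>\<^sub>v x)) $ j"
      using mult_mat_vec[OF pow_carrier_mat[OF S(1)] x] Suc.prems S x by simp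
    also have "\<dots> \<le> (S ^\<^sub>m m *\<^sub>v (S ^\<^sub>m (m * p) *\<^sub>v x)) $ j"
      using Suc.IH x Suc.prems
      by (intro mult_mat_vec_mono[OF pow_carrier_mat[OF S(1)] nonneg_mat_pow[OF S] _ Sc])
        (auto simp del: index_mult_mat_vec)
    also have "\<dots> = (S ^\<^sub>m (m * Suc p) *\<^sub>v x) $ j"
      using pow_mat_add_mult_vec[OF S(1) x, of m "m * p"] by simp
    finally show ?case .
  qed
  obtain c where c: "\<And>k i j. i < n \<Longrightarrow> j < n \<Longrightarrow> \<bar>(S ^\<^sub>m k) $$ (i,j)\<bar> \<le> c"
    using pow_mat_bounded_if_spectral_radius_less[OF A(1) n r0 r(1)] unfolding S_def by blast
  \<comment> \<open>\<open>p\<close> is chosen so that the growth \<open>t ^ p * x $ 0\<close> in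
    row 0 passes the bound that entries of size at most \<open>c\<close> allow.\<close>
  obtain p where p: "(\<Sum>j<n. c * x $ j) / x $ 0 < t ^ p" using real_arch_pow[OF t] by blast
  have "(S ^\<^sub>m (m * p) *\<^sub>v x) $ 0 \<le> (\<Sum>j<n. c * x $ j)"
    unfolding mult_mat_vec_sum[OF pow_carrier_mat[OF S(1)] x n]
    using abs_le_D1[OF c[OF n]] pos by (intro sum_mono mult_right_mono) (auto simp: less_imp_le)
  then have "t ^ p * x $ 0 \<le> (\<Sum>j<n. c * x $ j)" using grow[OF n, of p] by linarith
  then show False using p pos[OF n] by (simp add: pos_divide_less_eq)
qed

section \<open>Irreducible matrices\<close>

text \<open>Otherwise the zero set of \<open>w\<close>, moved to the end by a permutation, exhibits a zero block.\<close>

lemma irreducible_mat_spreads_support: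
  assumes B: "B \<in> carrier_mat n n" "nonneg_mat B" "irreducible_mat B"
    and w: "w \<in> carrier_vec n" "\<And>i. i < n \<Longrightarrow> 0 \<le> w $ i"
    and pos: "i0 < n" "0 < w $ i0" and zero: "i1 < n" "w $ i1 = 0"
  shows "\<exists>i<n. w $ i = 0 \<and> 0 < (B *\<^sub>v w) $ i"
proof (rule ccontr)
  assume "\<not> ?thesis"
  then have Bw: "(B *\<^sub>v w) $ i = 0" if "i < n" "w $ i = 0" for i
    using that mult_mat_vec_nonneg[OF B(1,2) w that(1)] by force
  \<comment> \<open>A vanishing sum of nonnegative terms has only zero terms, so no row outside the
    support of \<open>w\<close> has a nonzero entry in a column of the support.\<close>
  have B0: "B $$ (i,j) = 0" if "i < n" "w $ i = 0" "j < n" "w $ j \<noteq> 0" for i j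
  proof -
    have "\<forall>j\<in>{..<n}. B $$ (i,j) * w $ j = 0"
      using Bw[OF that(1,2)] nonneg_matD[OF B(2,1) that(1)] w(2)
      unfolding mult_mat_vec_sum[OF B(1) w(1) that(1)]
      by (subst (asm) sum_nonneg_eq_0_iff) auto
    then show ?thesis using that by auto
  qed
  define U where "U = {i. i < n \<and> w $ i \<noteq> 0}"
  define V where "V = {i. i < n \<and> w $ i = 0}"
  define r where "r = card U"
  define s where "s = card V"
  have fin: "finite U" "finite V" by (auto simp: U_def V_def)
  have UV: "U \<union> V = {..<n}" "U \<inter> V = {}" by (auto simp: U_def V_def)
  have n: "n = r + s" using card_Un_disjoint[OF fin UV(2)] UV(1) by (simp add: r_def s_def)
  have "U \<noteq> {}" "V \<noteq> {}" using pos zero by (auto simp: U_def V_def)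
  then have rs: "0 < r" "0 < s" using fin by (auto simp: r_def s_def card_gt_0_iff)
  obtain f where f: "bij_betw f {..<r} U"
    using finite_same_card_bij[of "{..<r}" U] fin by (auto simp: r_def)
  obtain g where g: "bij_betw g {r..<n} V"
    using finite_same_card_bij[of "{r..<n}" V] fin n by (auto simp: s_def)
  \<comment> \<open>\<open>p\<close> lists the support \<open>U\<close> first and the zero set
    \<open>V\<close> after it; being the identity from \<open>n\<close> on makes it a permutation of
    \<open>{..<n}\<close> in the sense of \<open>permutes\<close>.\<close>
  define p where "p i = (if i < r then f i else if i < n then g i else i)" for i
  have p1: "bij_betw p {..<r} U" using f by (subst bij_betw_cong[of _ _ f]) (auto simp: p_def)
  have p2: "bij_betw p {r..<n} V" using g by (subst bij_betw_cong[of _ _ g]) (auto simp: p_def)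
  have "{..<r} \<union> {r..<n} = {..<n}" using n by auto
  with bij_betw_combine[OF p1 p2 UV(2)] UV(1) have "bij_betw p {..<n} {..<n}" by simp
  then have perm: "p permutes {..<n}" using n by (intro bij_imp_permutes) (auto simp: p_def)
  have pn: "p i < n" if "i < n" for i using permutes_in_image[OF perm] that by auto
  define P where "P = mat n n (\<lambda>(i,j). if j = p i then 1 else (0::real))"
  define Q where "Q = mat n n (\<lambda>(i,j). B $$ (p i, p j))"
  have P: "P \<in> carrier_mat n n" by (simp add: P_def)
  \<comment> \<open>Row \<open>i\<close> of \<open>P\<close> has its single 1 in column
    \<open>p i\<close>: multiplication from the left selects row \<open>p i\<close>, and the
    transpose on the right selects column \<open>p j\<close>.\<close>
  have PB: "P * B = mat n n (\<lambda>(i,j). B $$ (p i, j))"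
    using B pn by (intro eq_matI) (auto simp: P_def scalar_prod_def if_distrib if_distribR sum.delta cong: if_cong)
  have PBP: "P * B * transpose_mat P = Q"
    unfolding PB Q_def
    using B pn by (intro eq_matI) (auto simp: P_def scalar_prod_def if_distrib if_distribR sum.delta cong: if_cong)
  have Q0: "Q $$ (i,j) = 0" if "r \<le> i" "i < n" "j < r" for i j
  proof -
    have "p i \<in> V" using p2 that by (auto simp: bij_betw_def)
    moreover have "p j \<in> U" using p1 that by (auto simp: bij_betw_def)
    ultimately show ?thesis using B0 that n by (auto simp: Q_def U_def V_def)
  qed
  define X where "X = mat r r (\<lambda>(i,j). Q $$ (i,j))"
  define Y where "Y = mat r s (\<lambda>(i,j). Q $$ (i,j + r))"
  define Z where "Z = mat s s (\<lambda>(i,j). Q $$ (i + r,j + r))"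
  have "Q = four_block_mat X Y (0\<^sub>m s r) Z"
  proof (intro eq_matI)
    fix i j assume "i < dim_row (four_block_mat X Y (0\<^sub>m s r) Z)"
      "j < dim_col (four_block_mat X Y (0\<^sub>m s r) Z)"
    then have "i < n" "j < n" by (auto simp: X_def Z_def n)
    then show "Q $$ (i,j) = four_block_mat X Y (0\<^sub>m s r) Z $$ (i,j)"
      using Q0[of i j] n by (auto simp: X_def Y_def Z_def)
  qed (auto simp: Q_def X_def Z_def n)
  with PBP have "P * B * transpose_mat P = four_block_mat X Y (0\<^sub>m s r) Z" by simp
  moreover have "is_permutation_mat (r + s) P"
    unfolding is_permutation_mat_def P_def n[symmetric] using perm by blast
  moreover have "X \<in> carrier_mat r r" "Y \<in> carrier_mat r s" "Z \<in> carrier_mat s s"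
    by (simp_all add: X_def Y_def Z_def)
  moreover have "B \<in> carrier_mat (r + s) (r + s)" using B(1) n by simp
  ultimately have "reducible_mat B"
    unfolding reducible_mat_def using rs by blast
  with B(3) show False by (simp add: irreducible_mat_def)
qed

text \<open>Replacing \<open>y\<close> by \<open>y + B y\<close> replaces the defect \<open>w = \<plusminus>(L y - B y)\<close> by \<open>w + B w\<close>,
  whose support is strictly larger. The sign \<open>s\<close> treats both inequalities at once.\<close>

lemma irreducible_mat_strict_everywhere:
  fixes s L :: real
  assumes B: "B \<in> carrier_mat n n" "nonneg_mat B" "irreducible_mat B"
    and "y \<in> carrier_vec n" "\<And>i. i < n \<Longrightarrow> 0 < y $ i"
    and "\<And>i. i < n \<Longrightarrow> 0 \<le> s * (L * y $ i - (B *\<^sub>v y) $ i)"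
    and "\<exists>i<n. 0 < s * (L * y $ i - (B *\<^sub>v y) $ i)"
  shows "\<exists>y'. y' \<in> carrier_vec n \<and> (\<forall>i<n. 0 < y' $ i) \<and>
    (\<forall>i<n. 0 < s * (L * y' $ i - (B *\<^sub>v y') $ i))"
  using assms(4-7)
proof (induction "card {i. i < n \<and> s * (L * y $ i - (B *\<^sub>v y) $ i) = 0}"
    arbitrary: y rule: less_induct)
  case less
  note y = less.prems(1,2)
  define w where "w = vec n (\<lambda>i. s * (L * y $ i - (B *\<^sub>v y) $ i))"
  have w: "w \<in> carrier_vec n" by (simp add: w_def)
  have w0: "0 \<le> w $ i" if "i < n" for i
    using less.prems(3) that by (simp add: w_def del: index_mult_mat_vec)
  obtain i0 where i0: "i0 < n" "0 < w $ i0"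
    using less.prems(4) by (auto simp: w_def simp del: index_mult_mat_vec)
  show ?case
  proof (cases "\<exists>i<n. w $ i = 0")
    case False
    then have "0 < w $ i" if "i < n" for i using w0[OF that] that by force
    then have "\<forall>i<n. 0 < s * (L * y $ i - (B *\<^sub>v y) $ i)"
      by (simp add: w_def del: index_mult_mat_vec)
    then show ?thesis using y by blast
  next
    case True
    then obtain i1 where i1: "i1 < n" "w $ i1 = 0" by blast
    obtain i2 where i2: "i2 < n" "w $ i2 = 0" "0 < (B *\<^sub>v w) $ i2"
      using irreducible_mat_spreads_support[OF B w w0 i0 i1] by blast
    have By: "B *\<^sub>v y \<in> carrier_vec n" using B(1) y(1) by (rule mult_mat_vec_carrier)
    define y' where "y' = y + B *\<^sub>v y"
    have y': "y' \<in> carrier_vec n" using y By by (simp add: y'_def)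
    have y'i: "y' $ i = y $ i + (B *\<^sub>v y) $ i" if "i < n" for i
      using that B By by (simp add: y'_def del: index_mult_mat_vec)
    have Bpos: "0 \<le> (B *\<^sub>v y) $ i" if "i < n" for i
      using mult_mat_vec_nonneg[OF B(1,2) y(1) _ that] y(2) by (simp add: less_imp_le)
    have pos': "0 < y' $ i" if "i < n" for i using y'i y(2) Bpos that by (simp add: add_pos_nonneg)
    \<comment> \<open>By linearity, \<open>B\<close> maps the defect of \<open>y\<close> to the
      defect of \<open>B *\<^sub>v y\<close>.\<close>
    have Bw: "(B *\<^sub>v w) $ i = s * (L * (B *\<^sub>v y) $ i - (B *\<^sub>v (B *\<^sub>v y)) $ i)" if "i < n" for i
      unfolding mult_mat_vec_sum[OF B(1) w that] mult_mat_vec_sum[OF B(1) y(1) that]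
        mult_mat_vec_sum[OF B(1) By that]
      by (simp add: w_def sum_distrib_left sum_subtractf right_diff_distrib ac_simps
          del: index_mult_mat_vec)
    have w': "s * (L * y' $ i - (B *\<^sub>v y') $ i) = w $ i + (B *\<^sub>v w) $ i" if "i < n" for i
    proof -
      have "(B *\<^sub>v y') $ i = (B *\<^sub>v y) $ i + (B *\<^sub>v (B *\<^sub>v y)) $ i"
        unfolding y'_def mult_add_distrib_mat_vec[OF B(1) y(1) By]
        using that B by (simp del: index_mult_mat_vec)
      moreover have "w $ i = s * (L * y $ i - (B *\<^sub>v y) $ i)"
        using that by (simp add: w_def del: index_mult_mat_vec)
      ultimately show ?thesis
        unfolding Bw[OF that] y'i[OF that] by (simp add: algebra_simps del: index_mult_mat_vec)
    qed
    have Bw0: "0 \<le> (B *\<^sub>v w) $ i" if "i < n" for i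
      by (rule mult_mat_vec_nonneg[OF B(1,2) w w0 that])
    \<comment> \<open>The new defect is a sum of two nonnegative terms, so no zero is created, and
      \<open>i2\<close> ceases to be one. Hence the induction measure drops.\<close>
    have "{i. i < n \<and> s * (L * y' $ i - (B *\<^sub>v y') $ i) = 0} \<subset> {i. i < n \<and> w $ i = 0}"
    proof
      show "{i. i < n \<and> s * (L * y' $ i - (B *\<^sub>v y') $ i) = 0} \<subseteq> {i. i < n \<and> w $ i = 0}"
      proof
        fix i assume "i \<in> {i. i < n \<and> s * (L * y' $ i - (B *\<^sub>v y') $ i) = 0}"
        then have "i < n" "w $ i + (B *\<^sub>v w) $ i = 0"
          using w'[of i] by (auto simp del: index_mult_mat_vec mult_eq_0_iff)
        then show "i \<in> {i. i < n \<and> w $ i = 0}"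
          using add_nonneg_eq_0_iff[OF w0 Bw0] by blast
      qed
      have "i2 \<notin> {i. i < n \<and> s * (L * y' $ i - (B *\<^sub>v y') $ i) = 0}"
        using w'[OF i2(1)] i2(2,3) by (simp del: index_mult_mat_vec mult_eq_0_iff)
      then show "{i. i < n \<and> s * (L * y' $ i - (B *\<^sub>v y') $ i) = 0} \<noteq> {i. i < n \<and> w $ i = 0}"
        using i2 by blast
    qed
    moreover have "{i. i < n \<and> w $ i = 0} = {i. i < n \<and> s * (L * y $ i - (B *\<^sub>v y) $ i) = 0}"
      by (auto simp: w_def simp del: index_mult_mat_vec)
    ultimately have "card {i. i < n \<and> s * (L * y' $ i - (B *\<^sub>v y') $ i) = 0}
        < card {i. i < n \<and> s * (L * y $ i - (B *\<^sub>v y) $ i) = 0}"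
      by (intro psubset_card_mono) auto
    then show ?thesis
    proof (rule less.hyps[OF _ y' pos'])
      show "0 \<le> s * (L * y' $ i - (B *\<^sub>v y') $ i)" if "i < n" for i
        unfolding w'[OF that] using w0 Bw0 that by simp
      show "\<exists>i<n. 0 < s * (L * y' $ i - (B *\<^sub>v y') $ i)"
        using i0(1) add_pos_nonneg[OF i0(2) Bw0[OF i0(1)]] unfolding w'[OF i0(1), symmetric] by blast
    qed
  qed
qed

text \<open>Subtract from \<open>z\<close> the largest multiple of \<open>x\<close> that leaves a
  nonnegative vector \<open>w\<close>. It has a zero entry, and \<open>B *\<^sub>v w\<close> is a
  multiple of \<open>w\<close>, so its support cannot spread; irreducibility then forces
  \<open>w\<close> to vanish. No sign condition on \<open>z\<close> is imposed.\<close>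

lemma irreducible_mat_positive_eigenvector_unique:
  assumes B: "B \<in> carrier_mat n n" "nonneg_mat B" "irreducible_mat B" and n: "0 < n"
    and x: "x \<in> carrier_vec n" "\<And>i. i < n \<Longrightarrow> 0 < x $ i" "B *\<^sub>v x = \<mu> \<cdot>\<^sub>v x"
    and z: "z \<in> carrier_vec n" "B *\<^sub>v z = \<mu> \<cdot>\<^sub>v z"
  shows "\<exists>c. z = c \<cdot>\<^sub>v x"
proof -
  define g where "g i = z $ i / x $ i" for i
  define t where "t = Min (g ` {..<n})"
  have ne: "g ` {..<n} \<noteq> {}" using n by auto
  have "t \<in> g ` {..<n}" unfolding t_def using ne by (intro Min_in) auto
  then obtain i1 where i1: "i1 < n" "t = g i1" by auto
  define w where "w = z + (- t) \<cdot>\<^sub>v x"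
  have w: "w \<in> carrier_vec n" using x z by (simp add: w_def)
  have wi: "w $ i = z $ i - t * x $ i" if "i < n" for i using that x z by (simp add: w_def)
  have w0: "0 \<le> w $ i" if "i < n" for i
  proof -
    have "t \<le> g i" unfolding t_def using that by (intro Min_le) auto
    then have "t * x $ i \<le> z $ i" using x(2)[OF that] by (simp add: g_def field_simps)
    then show ?thesis using wi[OF that] by simp
  qed
  have w1: "w $ i1 = 0" using wi[OF i1(1)] i1 x(2)[OF i1(1)] by (simp add: g_def)
  have "B *\<^sub>v w = B *\<^sub>v z + (- t) \<cdot>\<^sub>v (B *\<^sub>v x)"
    unfolding w_def using B(1) x(1) z(1)
    by (subst mult_add_distrib_mat_vec[of _ n n]) (auto simp: mult_mat_vec[of _ n n])
  then have Bw: "(B *\<^sub>v w) $ i = \<mu> * w $ i" if "i < n" for i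
    using that x z by (simp add: w_def algebra_simps del: index_mult_mat_vec)
  have "w $ i = 0" if "i < n" for i
  proof (rule ccontr)
    assume "w $ i \<noteq> 0"
    then have "0 < w $ i" using w0[OF that] by simp
    from irreducible_mat_spreads_support[OF B w w0 that this i1(1) w1]
    show False using Bw by auto
  qed
  then have "z = t \<cdot>\<^sub>v x" using wi x z by (intro eq_vecI) auto
  then show ?thesis by blast
qed

text \<open>Used for both equality cases: \<open>s = 1\<close> encodes that the \<open>m\<close>-th
  power of \<open>A\<close> enlarges \<open>x\<close> at most by the factor \<rho>^m, and
  \<open>s = -1\<close> that it does so at least.\<close>

lemma irreducible_mat_pow_eigenvector:
  fixes s :: real
  assumes A: "A \<in> carrier_mat n n" "nonneg_mat A" and irr: "irreducible_mat (A ^\<^sub>m m)"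
    and n: "0 < n" and m: "0 < m"
    and x: "x \<in> carrier_vec n" "\<And>i. i < n \<Longrightarrow> 0 < x $ i"
    and s: "s = 1 \<or> s = -1"
    and le: "\<And>i. i < n \<Longrightarrow> 0 \<le> s * (real_spectral_radius A ^ m * x $ i - (A ^\<^sub>m m *\<^sub>v x) $ i)"
  shows "\<exists>c. eigenvector A x c"
proof -
  let ?B = "A ^\<^sub>m m" and ?\<rho> = "real_spectral_radius A"
  have B: "?B \<in> carrier_mat n n" "nonneg_mat ?B" using A nonneg_mat_pow by auto
  have "(?B *\<^sub>v x) $ i = ?\<rho> ^ m * x $ i" if i: "i < n" for i
  proof (rule ccontr)
    assume "(?B *\<^sub>v x) $ i \<noteq> ?\<rho> ^ m * x $ i"
    then have "0 < s * (?\<rho> ^ m * x $ i - (?B *\<^sub>v x) $ i)" using le[OF i] s by auto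
    then obtain y where y: "y \<in> carrier_vec n" "\<And>i. i < n \<Longrightarrow> 0 < y $ i"
      and strict: "\<And>i. i < n \<Longrightarrow> 0 < s * (?\<rho> ^ m * y $ i - (?B *\<^sub>v y) $ i)"
      using irreducible_mat_strict_everywhere[OF B irr x le] i by blast
    \<comment> \<open>Strictness at all indices of the positive vector \<open>y\<close> contradicts
      \<open>spectral_radius_pow_le_at\<close> if \<open>s = 1\<close> and
      \<open>spectral_radius_pow_ge_at\<close> if \<open>s = -1\<close>.\<close>
    show False
      using spectral_radius_pow_le_at[OF A n y, of m] spectral_radius_pow_ge_at[OF A n m y] strict s
      by fastforce
  qed
  then have Bx: "?B *\<^sub>v x = ?\<rho> ^ m \<cdot>\<^sub>v x" using x B by (intro eq_vecI) auto
  have Ax: "A *\<^sub>v x \<in> carrier_vec n" using A(1) x(1) by (rule mult_mat_vec_carrier)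
  \<comment> \<open>Commutation makes \<open>A *\<^sub>v x\<close> satisfy the same eigenvector
    equation for \<open>?B\<close> as \<open>x\<close>, so uniqueness makes it a multiple of
    \<open>x\<close>.\<close>
  have "?B *\<^sub>v (A *\<^sub>v x) = A *\<^sub>v (?B *\<^sub>v x)"
    using pow_mat_add_mult_vec[OF A(1) x(1), of m 1] pow_mat_add_mult_vec[OF A(1) x(1), of 1 m] A
    by (simp add: add.commute)
  also have "\<dots> = ?\<rho> ^ m \<cdot>\<^sub>v (A *\<^sub>v x)" unfolding Bx using A x by (simp add: mult_mat_vec[of _ n n])
  finally obtain c where c: "A *\<^sub>v x = c \<cdot>\<^sub>v x"
    using irreducible_mat_positive_eigenvector_unique[OF B irr n x Bx Ax] by blast
  moreover have "x \<noteq> 0\<^sub>v n" using x(2)[OF n] n by auto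
  ultimately show ?thesis using A x by (auto simp: eigenvector_def)
qed

text \<open>On an eigenvector the Collatz--Wielandt quotient is \<open>c\<close> at every index, so
  the two bounds with exponent 1 enclose \<open>c\<close> from both sides.\<close>

lemma positive_eigenvector_eigenvalue:
  assumes A: "A \<in> carrier_mat n n" "nonneg_mat A" and n: "0 < n"
    and pos: "\<And>i. i < n \<Longrightarrow> 0 < x $ i" and ev: "eigenvector A x c"
  shows "c = real_spectral_radius A"
proof -
  have x: "x \<in> carrier_vec n" and Ax: "A *\<^sub>v x = c \<cdot>\<^sub>v x" using ev A by (auto simp: eigenvector_def)
  have "(A ^\<^sub>m 1 *\<^sub>v x) $ i = c * x $ i" if "i < n" for i
    using that Ax x A by (simp del: index_mult_mat_vec)
  then show ?thesis
    using spectral_radius_pow_le_at[OF A n x pos, of 1] spectral_radius_pow_ge_at[OF A n _ x pos, of 1]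
      pos by force
qed

section \<open>The row sum bounds\<close>

theorem theorem7:
  fixes A :: "real mat" and n M N k :: nat
  assumes "0 < n" and "A \<in> carrier_mat n n"
    and "nonneg_mat A"
    and "\<And>i. i < n \<Longrightarrow> row_sum A i \<noteq> 0"
    and "0 < M"
  shows "Min (row_sum_ratios A M N k) \<le> real_spectral_radius A \<and>
         real_spectral_radius A \<le> Max (row_sum_ratios A M N k) \<and>
         (irreducible_mat (A ^\<^sub>m (M + N)) \<longrightarrow>
            (Min (row_sum_ratios A M N k) = real_spectral_radius A \<longleftrightarrow>
               (\<exists>c. eigenvector A (row_sums_vec (A ^\<^sub>m k)) c)) \<and>
            (real_spectral_radius A = Max (row_sum_ratios A M N k) \<longleftrightarrow>
               (\<exists>c. eigenvector A (row_sums_vec (A ^\<^sub>m k)) c)))"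
proof -
  note n = assms(1) and A = assms(2,3) and nz = assms(4)
  define x where "x = row_sums_vec (A ^\<^sub>m k)"

  \<comment> \<open>The ratios in terms of the iterates of \<open>x\<close>\<close>
  let ?\<rho> = "real_spectral_radius A" and ?R = "row_sum_ratios A M N k" and ?m = "M + N"
  define a where "a l i = (A ^\<^sub>m l *\<^sub>v x) $ i" for l i
  have m: "0 < ?m" using assms(5) by simp
  have x_eq: "x = A ^\<^sub>m k *\<^sub>v vec n (\<lambda>_. 1)"
    unfolding x_def using A by (simp add: row_sums_vec_eq_mult_one[of _ n])
  have x: "x \<in> carrier_vec n" using A by (simp add: x_def row_sums_vec_def carrier_vecI)
  have xpos: "0 < x $ i" if "i < n" for i
    unfolding x_eq using pow_mat_mult_vec_pos[OF A _ nz _ that] by simp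
  have apos: "0 < a l i" if "i < n" for l i
    unfolding a_def using pow_mat_mult_vec_pos[OF A x nz xpos that] .
  define f where "f i j = (a M i * a N j / (x $ i * x $ j)) powr (1 / real ?m)" for i j
  have R: "?R = {f i j | i j. i < n \<and> j < n \<and> (A ^\<^sub>m M) $$ (i,j) > 0}"
  proof -
    have "row_sum (A ^\<^sub>m (k + l)) i = a l i" if "i < n" for l i
      using row_sum_pow_add[OF A(1) that] by (simp add: a_def x_def)
    moreover have "row_sum (A ^\<^sub>m k) i = x $ i" if "i < n" for i
      using that A by (simp add: x_def row_sums_vec_def)
    moreover have "dim_row A = n" using A by simp
    ultimately show ?thesis
      unfolding row_sum_ratios_def f_def by (intro Collect_cong) (metis (no_types, lifting))
  qed
  have finR: "finite ?R"
    by (rule finite_subset[of _ "case_prod f ` ({..<n} \<times> {..<n})"]) (auto simp: R)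
  have root: "(c powr (1 / real ?m)) ^ ?m = c" if "0 < c" for c
  proof -
    have "(c powr (1 / real ?m)) ^ ?m = c powr (real ?m * (1 / real ?m))"
      using that by (intro powr_power) simp
    also have "real ?m * (1 / real ?m) = 1" using m by (simp del: of_nat_add)
    finally show ?thesis using that by simp
  qed
  have fpow: "f i j ^ ?m * (x $ i * x $ j) = a M i * a N j" if "i < n" "j < n" for i j
  proof -
    have "0 < a M i * a N j / (x $ i * x $ j)" using apos xpos that by simp
    then have "f i j ^ ?m = a M i * a N j / (x $ i * x $ j)"
      unfolding f_def by (rule root)
    then show ?thesis using xpos[OF that(1)] xpos[OF that(2)] by simp
  qed
  have f0: "0 \<le> f i j" for i j by (simp add: f_def)
  \<comment> \<open>If row 0 of the \<open>M\<close>-th power had no positive entry, then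
    \<open>a M 0\<close> could not be positive. Nonemptiness gives \<open>Min\<close> and
    \<open>Max\<close> their meaning.\<close>
  have R_nonempty: "?R \<noteq> {}"
  proof
    assume "?R = {}"
    then have "(A ^\<^sub>m M) $$ (0,j) \<le> 0" if "j < n" for j
      unfolding R using n that by (metis (mono_tags, lifting) empty_Collect_eq not_le)
    then have "(\<Sum>j<n. (A ^\<^sub>m M) $$ (0,j) * x $ j) \<le> 0"
      using xpos by (intro sum_nonpos) (simp add: mult_nonpos_nonneg less_imp_le)
    then show False
      using apos[OF n, of M] mult_mat_vec_sum[OF pow_carrier_mat[OF A(1)] x n] by (simp add: a_def)
  qed

  \<comment> \<open>The two bounds\<close>
  define l where "l = Min ?R"
  define h where "h = Max ?R"
  have l: "l \<le> f i j" and h: "f i j \<le> h" if "i < n" "j < n" "0 < (A ^\<^sub>m M) $$ (i,j)" for i j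
    unfolding l_def h_def using finR that R by (auto intro: Min_le Max_ge)
  have l0: "0 \<le> l" and h0: "0 \<le> h"
    unfolding l_def h_def
    using Min_in[OF finR R_nonempty] Max_in[OF finR R_nonempty] f0 R by auto
  have AN: "A ^\<^sub>m N *\<^sub>v x \<in> carrier_vec n"
    using pow_carrier_mat[OF A(1)] x by (rule mult_mat_vec_carrier)
  \<comment> \<open>The product of the \<open>M\<close>-th power with the \<open>N\<close>-th power
    applied to \<open>x\<close> is folded into \<open>a ?m\<close>, so the comparison speaks
    directly about the exponent \<open>M + N\<close>.\<close>
  note cmp = mult_mat_vec_compare[OF pow_carrier_mat[OF A(1)] nonneg_mat_pow[OF A] x AN,
      folded pow_mat_add_mult_vec[OF A(1) x], folded a_def]
  have lower: "l ^ ?m * x $ i \<le> a ?m i" if i: "i < n" for i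
  proof (rule cmp(1)[OF i apos[OF i]])
    fix j assume j: "j < n" "0 < (A ^\<^sub>m M) $$ (i,j)"
    show "l ^ ?m * (x $ i * x $ j) \<le> a M i * a N j"
      unfolding fpow[OF i j(1), symmetric] using l[OF i j] l0 xpos i j
      by (intro mult_right_mono power_mono) (auto simp: less_imp_le)
  qed
  have upper: "a ?m i \<le> h ^ ?m * x $ i" if i: "i < n" for i
  proof (rule cmp(2)[OF i apos[OF i]])
    fix j assume j: "j < n" "0 < (A ^\<^sub>m M) $$ (i,j)"
    show "a M i * a N j \<le> h ^ ?m * (x $ i * x $ j)"
      unfolding fpow[OF i j(1), symmetric] using h[OF i j] f0 xpos i j
      by (intro mult_right_mono power_mono) (auto simp: less_imp_le)
  qed
  have \<rho>: "0 \<le> ?\<rho>" by (rule real_spectral_radius_nonneg[OF A(1) n])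
  \<comment> \<open>At this one index the entrywise lower bound meets the Collatz--Wielandt bound;
    cancelling \<open>x $ i > 0\<close> and comparing bases of the \<open>m\<close>-th powers gives
    \<open>l_le\<close>.\<close>
  obtain i where i: "i < n" "a ?m i \<le> ?\<rho> ^ ?m * x $ i"
    using spectral_radius_pow_ge_at[OF A n m x xpos] unfolding a_def by blast
  have "l ^ ?m * x $ i \<le> ?\<rho> ^ ?m * x $ i" using lower[OF i(1)] i(2) by simp
  then have l_le: "l \<le> ?\<rho>"
    using xpos[OF i(1)] \<rho> m power_mono_iff[OF l0 \<rho> m] by simp
  obtain j where j: "j < n" "?\<rho> ^ ?m * x $ j \<le> a ?m j"
    using spectral_radius_pow_le_at[OF A n x xpos] unfolding a_def by blast
  have "?\<rho> ^ ?m * x $ j \<le> h ^ ?m * x $ j" using upper[OF j(1)] j(2) by simp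
  then have h_ge: "?\<rho> \<le> h"
    using xpos[OF j(1)] \<rho> m power_mono_iff[OF \<rho> h0 m] by simp

  \<comment> \<open>The equality cases\<close>
  have eq_if: "l = ?\<rho> \<and> ?\<rho> = h" if ev: "eigenvector A x c" for c
  proof -
    have c: "c = ?\<rho>" by (rule positive_eigenvector_eigenvalue[OF A n xpos ev])
    have al: "a l i = ?\<rho> ^ l * x $ i" if "i < n" for l i
      unfolding a_def eigenvector_pow[OF A(1) ev] using that x c by simp
    \<comment> \<open>The factors \<rho>^M and \<rho>^N multiply to \<rho>^(M+N), so every ratio is
      \<rho> and the minimum and maximum coincide.\<close>
    have "f i j = ?\<rho>" if "i < n" "j < n" for i j
    proof -
      have "f i j ^ ?m * (x $ i * x $ j) = ?\<rho> ^ ?m * (x $ i * x $ j)"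
        unfolding fpow[OF that] using al that by (simp add: power_add)
      then have "f i j ^ ?m = ?\<rho> ^ ?m" using xpos[OF that(1)] xpos[OF that(2)] by simp
      then show ?thesis using power_eq_iff_eq_base[OF m f0 \<rho>] by simp
    qed
    then have "?R \<subseteq> {?\<rho>}" unfolding R by auto
    then have "?R = {?\<rho>}" using R_nonempty by auto
    then show ?thesis by (simp add: l_def h_def)
  qed
  \<comment> \<open>With \<open>l = ?\<rho>\<close>, \<open>lower\<close> is the hypothesis with
    sign -1; in the other case \<open>upper\<close> is the one with sign 1.\<close>
  have "\<exists>c. eigenvector A x c" if "irreducible_mat (A ^\<^sub>m ?m)" "l = ?\<rho>"
    using irreducible_mat_pow_eigenvector[OF A that(1) n m x xpos, of "-1"] lower that(2)
    by (simp add: a_def del: index_mult_mat_vec)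
  moreover have "\<exists>c. eigenvector A x c" if "irreducible_mat (A ^\<^sub>m ?m)" "?\<rho> = h"
    using irreducible_mat_pow_eigenvector[OF A that(1) n m x xpos, of 1] upper that(2)
    by (simp add: a_def del: index_mult_mat_vec)
  ultimately show ?thesis
    using l_le h_ge eq_if unfolding l_def h_def x_def by blast
qed

end
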